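(* Let $n$ be a non-negative integer and let $q,a,c$ be non-zero complex numbers such that no denominator on either side below vanishes. Then $${}_4\phi_3\left[\begin{matrix} q^{-2n},\ c^2,\ a,\ aq\\ a^2q^2,\ cq^{-n},\ cq^{-n+1}\end{matrix};q^2,q^2\right]=\frac{(-q,\,aq/c;q)_n}{(-aq,\,q/c;q)_n} ,$$ where the series on the left has base $q^2$ and argument $q^2$.
   Context: For complex $a,q$ and a non-negative integer $n$, $(a;q)_n:=\prod_{k=0}^{n-1}(1-aq^k)$, with $(a;q)_0=1$, and $(a_1,\ldots,a_k;q)_n:=\prod_{i=1}^k (a_i;q)_n$. The unilateral basic hypergeometric series is $${}_{r+1}\phi_r\left[\begin{matrix} a_0,\ldots,a_r\\ b_1,\ldots,b_r\end{matrix};q,z\right]:=\sum_{j=0}^{\infty}\frac{(a_0,\ldots,a_r;q)_j}{(q,b_1,\ldots,b_r;q)_j}z^j .$$ With base $q^2$, every $q$ in this definition is replaced by $q^2$. When the base is $q^2$ and one numerator parameter is $q^{-2n}=(q^2)^{-n}$ the series terminates and is read as the finite sum over $0\le j\le n$ (so no convergence condition on the argument is needed). *)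

theory Defs
  imports "HOL-Analysis.Analysis"
begin

definition qpoch :: "complex \<Rightarrow> complex \<Rightarrow> nat \<Rightarrow> complex" where
  "qpoch a q n = (\<Prod>k<n. 1 - a * q ^ k)"

definition qpochs :: "complex list \<Rightarrow> complex \<Rightarrow> nat \<Rightarrow> complex" where
  "qpochs as q n = (\<Prod>a\<leftarrow>as. qpoch a q n)"

(* The unilateral series with numerator parameters as = [a_0, ..., a_r] and denominator
   parameters bs = [b_1, ..., b_r], so length as = length bs + 1 is intended.
   The extra denominator factor (q;q)_j is supplied by the definition, and q is the base. *)
definition basic_hypergeom ::
    "complex list \<Rightarrow> complex list \<Rightarrow> complex \<Rightarrow> complex \<Rightarrow> complex" where
  "basic_hypergeom as bs q z = (\<Sum>j. qpochs as q j / qpochs (q # bs) q j * z ^ j)"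

(* If some numerator parameter is q^(-n), every numerator with j > n vanishes. As 0 / 0 = 0,
   those terms are 0 even where a denominator also vanishes, so the series is
   the finite sum over 0 <= j <= n, for every argument z. *)
lemma basic_hypergeom_terminating:
  assumes "q \<noteq> 0" and "q powi (- int n) \<in> set as"
  shows "basic_hypergeom as bs q z =
    (\<Sum>j\<le>n. qpochs as q j / qpochs (q # bs) q j * z ^ j)"
proof -
  have "qpochs as q j = 0" if "j \<notin> {..n}" for j
  proof -
    have "1 - q powi (- int n) * q ^ n = 0"
      using assms(1) by (simp add: power_int_minus field_simps)
    moreover have "n \<in> {..<j}" using that by simp
    ultimately have "qpoch (q powi (- int n)) q j = 0"
      unfolding qpoch_def by (intro prod_zero finite_lessThan bexI)
    then have "0 \<in> set (map (\<lambda>a. qpoch a q j) as)"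
      using assms(2) by force
    then show ?thesis
      unfolding qpochs_def by (simp only: prod_list_zero_iff)
  qed
  then show ?thesis
    unfolding basic_hypergeom_def by (intro suminf_finite) simp_all
qed

end

theory Submission
  imports Defs
begin

text \<open>
  Write \<open>p = q\<^sup>2\<close>. Since \<open>(a;p)\<^sub>j (aq;p)\<^sub>j = (a;q)\<^sub>2\<^sub>j\<close>, and likewise for the two denominator
  parameters containing \<open>c\<close>, multiplying the identity by \<open>(a\<^sup>2p;p)\<^sub>n (q/c;q)\<^sub>n\<close>, where
  \<open>(a\<^sup>2p;p)\<^sub>n = (aq;q)\<^sub>n (-aq;q)\<^sub>n\<close>, makes both sides polynomials in \<open>a\<close> of degree at most \<open>2n\<close>,
  with \<open>q\<close> and \<open>c\<close> fixed; the right-hand side becomes \<open>(-q;q)\<^sub>n (aq/c;q)\<^sub>n (aq;q)\<^sub>n\<close>.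
  It remains to compare them at \<open>2n + 1\<close> points, which are suggested by the right-hand side:

  \<^item> at \<open>a = 1\<close> only the term \<open>j = 0\<close> of the sum survives;
  \<^item> at \<open>a = q\<^sup>-\<^sup>k\<close> with \<open>1 \<le> k \<le> n\<close> the right-hand side is zero, and every term of the sum is zero
    (\<open>cleared_term_zero_at_powers\<close>);
  \<^item> at \<open>a = cq\<^sup>-\<^sup>k\<close> with \<open>1 \<le> k \<le> n\<close> the right-hand side is zero, and the quotients of shifted
    factorials in the sum collapse to a polynomial of degree at most \<open>n - 1\<close> in \<open>p\<^sup>j\<close>. The sum is then an
    \<open>n\<close>-th q-difference of this polynomial, so it is zero by the q-binomial theorem
    (\<open>q_difference_low_degree\<close>, \<open>cleared_sum_zero_at_shifts_of_c\<close>).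

  The points are pairwise distinct because the denominators \<open>(p;p)\<^sub>n\<close> and
  \<open>(cq\<^sup>-\<^sup>n;q)\<^sub>2\<^sub>n\<close> are non-zero.
\<close>

section \<open>Elementary identities for q-shifted factorials\<close>

lemma qpoch_0 [simp]: "qpoch a q 0 = 1"
  by (simp add: qpoch_def)

lemma qpoch_Suc: "qpoch a q (Suc n) = qpoch a q n * (1 - a * q ^ n)"
  by (simp add: qpoch_def)

lemma qpoch_Suc_left: "qpoch a q (Suc n) = (1 - a) * qpoch (a * q) q n"
  unfolding qpoch_def prod.lessThan_Suc_shift by (simp add: mult.assoc)

lemma qpoch_add: "qpoch a q (m + n) = qpoch a q m * qpoch (a * q ^ m) q n"
  by (induction n) (simp_all add: qpoch_Suc power_add mult_ac)

lemma qpoch_eq_0_iff: "qpoch a q n = 0 \<longleftrightarrow> (\<exists>k<n. a * q ^ k = 1)"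
  by (auto simp: qpoch_def)

lemma qpoch_eq_0I: "k < n \<Longrightarrow> a * q ^ k = 1 \<Longrightarrow> qpoch a q n = 0"
  using qpoch_eq_0_iff by blast

lemma qpoch_even_odd: "qpoch a (q\<^sup>2) n * qpoch (a * q) (q\<^sup>2) n = qpoch a q (2 * n)"
  by (induction n) (simp_all add: qpoch_Suc power_mult mult_ac flip: power_mult)

lemma qpoch_square: "qpoch (a\<^sup>2) (q\<^sup>2) n = qpoch a q n * qpoch (- a) q n"
  by (induction n)
     (simp_all add: qpoch_Suc algebra_simps power2_eq_square power_mult_distrib)

lemma qpoch_shift_swap:
  "qpoch x q m * qpoch (x * q ^ m) q n = qpoch x q n * qpoch (x * q ^ n) q m"
  by (metis add.commute qpoch_add)

text \<open>
  Both sides are the product of \<open>1 - x q\<^sup>i\<close> over the same multiset of exponents: the intervals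
  \<open>[l, l + j)\<close> and \<open>[j, n)\<close> have the same union with multiplicity as \<open>[j, j + l)\<close> and \<open>[l, n)\<close>.
  Formally this is \<open>(x;q)\<^sub>l\<^sub>+\<^sub>j (x;q)\<^sub>n\<close> divided by \<open>(x;q)\<^sub>l (x;q)\<^sub>j\<close>, but the divisor may be zero
  (later \<open>x = c\<^sup>2 p\<^sup>-\<^sup>l\<close>, and \<open>c = -1\<close> is possible), so the factors common to both sides are
  split off instead.
\<close>
lemma qpoch_exchange:
  assumes "j \<le> n" "l \<le> n"
  shows "qpoch (x * q ^ l) q j * qpoch (x * q ^ j) q (n - j)
       = qpoch (x * q ^ j) q l * qpoch (x * q ^ l) q (n - l)"
proof (cases "j + l \<le> n")
  case True
  have "qpoch (x * q ^ j) q (n - j) = qpoch (x * q ^ j) q l * qpoch (x * q ^ (j + l)) q (n - (j + l))"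
    using qpoch_add[of "x * q ^ j" q l "n - (j + l)"] True by (simp add: power_add mult_ac)
  moreover have "qpoch (x * q ^ l) q (n - l) = qpoch (x * q ^ l) q j * qpoch (x * q ^ (j + l)) q (n - (j + l))"
    using qpoch_add[of "x * q ^ l" q j "n - (j + l)"] True by (simp add: power_add mult_ac)
  ultimately show ?thesis by simp
next
  case False
  have shift: "x * q ^ i * q ^ (n - i) = x * q ^ n" if "i \<le> n" for i
    using that by (simp only: mult.assoc power_add[symmetric] le_add_diff_inverse)
  have "qpoch (x * q ^ l) q j = qpoch (x * q ^ l) q (n - l) * qpoch (x * q ^ n) q (j + l - n)"
    and "qpoch (x * q ^ j) q l = qpoch (x * q ^ j) q (n - j) * qpoch (x * q ^ n) q (j + l - n)"
    using qpoch_add[of "x * q ^ l" q "n - l" "j + l - n"]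
      qpoch_add[of "x * q ^ j" q "n - j" "j + l - n"] assms False
    unfolding shift[OF assms(1)] shift[OF assms(2)] by simp_all
  then show ?thesis by simp
qed

section \<open>The q-binomial theorem and q-differences\<close>

lemma qpoch_inverse_power:
  assumes "p \<noteq> 0"
  shows "qpoch (1 / p ^ n) p j * (p ^ n) ^ j = (\<Prod>k<j. p ^ n - p ^ k)"
  using assms by (induction j) (simp_all add: qpoch_Suc field_simps)

text \<open>
  The product over \<open>k < j\<close> is \<open>(p\<^sup>-\<^sup>n;p)\<^sub>j p\<^sup>n\<^sup>j\<close>, written without negative powers of \<open>p\<close>.
  The induction splits off the first factor, \<open>(x;p)\<^sub>n\<^sub>+\<^sub>1 = (1 - x) (xp;p)\<^sub>n\<close>, and compares
  coefficients of \<open>x\<^sup>j\<close>, which gives the q-Pascal rule named \<open>rec\<close> below.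
\<close>
lemma q_binomial:
  assumes "\<And>k. 1 \<le> k \<Longrightarrow> k \<le> n \<Longrightarrow> p ^ k \<noteq> 1"
  shows "qpoch x p n = (\<Sum>j\<le>n. (\<Prod>k<j. p ^ n - p ^ k) / qpoch p p j * x ^ j)"
  using assms
proof (induction n arbitrary: x)
  case 0
  then show ?case by simp
next
  case (Suc n)
  define N where "N m j = (\<Prod>k<j. p ^ m - p ^ k)" for m j
  define t where "t m j = N m j / qpoch p p j" for m j
  have N_Suc: "N (Suc n) (Suc j) = (p ^ Suc n - 1) * p ^ j * N n j" for j
    unfolding N_def prod.lessThan_Suc_shift
    by (simp add: prod.distrib flip: right_diff_distrib)
  have rec: "t (Suc n) (Suc j) = p ^ Suc j * t n (Suc j) - p ^ j * t n j" if "j \<le> n" for j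
  proof -
    define e where "e = 1 - p ^ Suc j"
    have "e \<noteq> 0"
      using Suc.prems[of "Suc j"] that by (simp add: e_def)
    moreover have "qpoch p p (Suc j) = qpoch p p j * e"
      by (simp add: qpoch_Suc e_def)
    moreover have "N n (Suc j) = N n j * (p ^ n - p ^ j)"
      by (simp add: N_def)
    ultimately have "t n j = N n j * e / qpoch p p (Suc j)"
      and "t n (Suc j) = N n j * (p ^ n - p ^ j) / qpoch p p (Suc j)"
      by (simp_all add: t_def)
    moreover have "(p ^ Suc n - 1) * p ^ j = p ^ Suc j * (p ^ n - p ^ j) - p ^ j * e"
      by (simp add: e_def algebra_simps)
    ultimately show ?thesis
      unfolding t_def[of "Suc n"] N_Suc
      by (simp add: mult.left_commute[of _ "N n j"] flip: diff_divide_distrib right_diff_distrib)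
  qed
  have t0: "t m 0 = 1" for m
    by (simp add: t_def N_def)
  have t_end: "t n (Suc n) = 0"
    by (simp add: t_def N_def)
  have "qpoch x p (Suc n) = (1 - x) * (\<Sum>j\<le>n. t n j * (x * p) ^ j)"
    using Suc by (simp add: qpoch_Suc_left t_def N_def)
  also have "\<dots> = (\<Sum>j\<le>Suc n. t n j * (x * p) ^ j) - (\<Sum>j\<le>n. x * (t n j * (x * p) ^ j))"
    by (simp add: t_end sum_distrib_left left_diff_distrib sum_subtractf)
  also have "\<dots> = 1 + (\<Sum>j\<le>n. (p ^ Suc j * t n (Suc j) - p ^ j * t n j) * x ^ Suc j)"
    unfolding sum.atMost_Suc_shift
    by (simp add: t0 algebra_simps power_mult_distrib sum_subtractf)
  also have "\<dots> = (\<Sum>j\<le>Suc n. t (Suc n) j * x ^ j)"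
    unfolding sum.atMost_Suc_shift by (simp add: t0 rec)
  finally show ?case
    by (simp add: t_def N_def)
qed

text \<open>
  For \<open>W(y) = y\<^sup>i\<close> the q-binomial theorem evaluates the sum to \<open>(p\<^sup>i\<^sup>+\<^sup>1\<^sup>-\<^sup>n;p)\<^sub>n\<close>, whose factor with
  index \<open>n - 1 - i\<close> is zero when \<open>i < n\<close>.
\<close>
lemma q_difference_low_degree:
  assumes "p \<noteq> 0" and "\<And>k. 1 \<le> k \<Longrightarrow> k \<le> n \<Longrightarrow> p ^ k \<noteq> 1"
    and "degree W < n"
  shows "(\<Sum>j\<le>n. qpoch (1 / p ^ n) p j / qpoch p p j * p ^ j * poly W (p ^ j)) = 0"
proof -
  have mono: "(\<Sum>j\<le>n. qpoch (1 / p ^ n) p j / qpoch p p j * p ^ j * (p ^ j) ^ i) = 0"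
    if "i < n" for i
  proof -
    have "p ^ j * (p ^ j) ^ i = (p ^ n) ^ j * (p ^ Suc i / p ^ n) ^ j" for j
      using assms(1) by (simp add: field_simps flip: power_mult power_add)
    then have "(\<Sum>j\<le>n. qpoch (1 / p ^ n) p j / qpoch p p j * p ^ j * (p ^ j) ^ i)
        = (\<Sum>j\<le>n. (\<Prod>k<j. p ^ n - p ^ k) / qpoch p p j * (p ^ Suc i / p ^ n) ^ j)"
      by (simp add: mult.assoc flip: qpoch_inverse_power[OF assms(1)])
    also have "\<dots> = qpoch (p ^ Suc i / p ^ n) p n"
      using assms(2) by (rule q_binomial[symmetric])
    also have "\<dots> = 0"
    proof (rule qpoch_eq_0I)
      show "n - Suc i < n" using that by simp
      have "p ^ Suc i * p ^ (n - Suc i) = p ^ n"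
        using that by (simp only: power_add[symmetric]) simp
      then show "p ^ Suc i / p ^ n * p ^ (n - Suc i) = 1"
        using assms(1) by simp
    qed
    finally show ?thesis .
  qed
  have "(\<Sum>j\<le>n. qpoch (1 / p ^ n) p j / qpoch p p j * p ^ j * poly W (p ^ j))
      = (\<Sum>i\<le>degree W. coeff W i *
          (\<Sum>j\<le>n. qpoch (1 / p ^ n) p j / qpoch p p j * p ^ j * (p ^ j) ^ i))"
    unfolding poly_altdef sum_distrib_left
    by (subst sum.swap) (simp add: mult_ac)
  also have "\<dots> = 0"
    using assms(3) by (intro sum.neutral ballI) (simp only: mono atMost_iff le_less_trans mult_zero_right)
  finally show ?thesis .
qed

section \<open>Polynomial dependence on a parameter\<close>

text \<open>
  Degree bounds are stated for functions, so that the shifted factorials can be used as they are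
  and no polynomial representing them has to be written down.
\<close>
definition poly_fun_le :: "nat \<Rightarrow> (complex \<Rightarrow> complex) \<Rightarrow> bool" where
  "poly_fun_le d f \<longleftrightarrow> (\<exists>W. degree W \<le> d \<and> (\<forall>x. f x = poly W x))"

lemma poly_fun_le_const: "poly_fun_le d (\<lambda>x. b)"
  unfolding poly_fun_le_def by (rule exI[of _ "[:b:]"]) simp

lemma poly_fun_le_mult:
  assumes "poly_fun_le d f" "poly_fun_le e g" "d + e \<le> m"
  shows "poly_fun_le m (\<lambda>x. f x * g x)"
proof -
  obtain U V where "degree U \<le> d" "\<And>x. f x = poly U x" "degree V \<le> e" "\<And>x. g x = poly V x"
    using assms by (auto simp: poly_fun_le_def)
  moreover have "degree (U * V) \<le> degree U + degree V"
    by (rule degree_mult_le)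
  ultimately show ?thesis
    using assms(3) unfolding poly_fun_le_def by (intro exI[of _ "U * V"]) simp
qed

lemma poly_fun_le_sum:
  assumes "\<And>i. i \<in> I \<Longrightarrow> poly_fun_le d (f i)"
  shows "poly_fun_le d (\<lambda>x. \<Sum>i\<in>I. f i x)"
proof -
  have "\<forall>i\<in>I. \<exists>W. degree W \<le> d \<and> (\<forall>x. f i x = poly W x)"
    using assms by (simp add: poly_fun_le_def)
  then obtain W where W: "\<And>i. i \<in> I \<Longrightarrow> degree (W i) \<le> d \<and> (\<forall>x. f i x = poly (W i) x)"
    by metis
  then have "degree (\<Sum>i\<in>I. W i) \<le> d"
    by (cases "finite I") (auto intro: degree_sum_le)
  with W show ?thesis
    unfolding poly_fun_le_def by (intro exI[of _ "\<Sum>i\<in>I. W i"]) (simp add: poly_sum)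
qed

lemma poly_fun_le_qpoch: "poly_fun_le n (\<lambda>x. qpoch (x * b) q n)"
proof (induction n)
  case 0
  then show ?case by (simp add: poly_fun_le_const)
next
  case (Suc n)
  have "poly_fun_le 1 (\<lambda>x. 1 - x * b * q ^ n)"
    unfolding poly_fun_le_def by (rule exI[of _ "[:1, - b * q ^ n:]"]) simp
  with Suc show ?case
    unfolding qpoch_Suc by (rule poly_fun_le_mult) simp
qed

lemma poly_fun_le_qpoch_square: "poly_fun_le (2 * n) (\<lambda>x. qpoch (x\<^sup>2 * b) q n)"
proof (induction n)
  case 0
  then show ?case by (simp add: poly_fun_le_const)
next
  case (Suc n)
  have "poly_fun_le 2 (\<lambda>x. 1 - x\<^sup>2 * b * q ^ n)"
    unfolding poly_fun_le_def
    by (rule exI[of _ "[:1, 0, - b * q ^ n:]"]) (simp add: power2_eq_square mult_ac)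
  with Suc show ?case
    unfolding qpoch_Suc by (rule poly_fun_le_mult) simp
qed

lemma poly_fun_le_eqI:
  assumes "poly_fun_le d f" "poly_fun_le d g" "card A > d"
    and "\<And>x. x \<in> A \<Longrightarrow> f x = g x"
  shows "f x = g x"
proof -
  obtain U V where "degree U \<le> d" "\<And>x. f x = poly U x" "degree V \<le> d" "\<And>x. g x = poly V x"
    using assms by (auto simp: poly_fun_le_def)
  moreover from this have "U = V"
    using assms(3,4) by (intro poly_eqI_degree[of A]) auto
  ultimately show ?thesis by simp
qed

section \<open>The summation formula with cleared denominators\<close>

text \<open>
  Put \<open>d = cq\<^sup>-\<^sup>n\<close>, \<open>m = n - k\<close>, \<open>l = k - 1\<close> and \<open>X = c\<^sup>2p\<^sup>-\<^sup>l\<close>. At \<open>a = cq\<^sup>-\<^sup>k = dq\<^sup>m\<close> the quotient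
  \<open>(a;q)\<^sub>2\<^sub>j / (d;q)\<^sub>2\<^sub>j\<close> equals \<open>(dp\<^sup>j;q)\<^sub>m / (d;q)\<^sub>m\<close>, and
  \<open>(c\<^sup>2;p)\<^sub>j (a\<^sup>2p\<^sup>j\<^sup>+\<^sup>1;p)\<^sub>n\<^sub>-\<^sub>j\<close> equals \<open>(Xp\<^sup>j;p)\<^sub>l (c\<^sup>2;p)\<^sub>n\<^sub>-\<^sub>l\<close>. Hence the summand depends on \<open>j\<close>
  through the q-difference weight and a polynomial in \<open>p\<^sup>j\<close> of degree at most \<open>m + l = n - 1\<close>.
\<close>
lemma cleared_sum_zero_at_shifts_of_c:
  fixes q c :: complex
  defines "p \<equiv> q\<^sup>2"
  assumes q0: "q \<noteq> 0"
    and p_root: "\<And>k. 1 \<le> k \<Longrightarrow> k \<le> n \<Longrightarrow> p ^ k \<noteq> 1"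
    and c_shift: "\<And>k. k < 2 * n \<Longrightarrow> c / q ^ n * q ^ k \<noteq> 1"
    and k: "1 \<le> k" "k \<le> n"
  shows "(\<Sum>j\<le>n. qpoch (1 / p ^ n) p j * qpoch (c\<^sup>2) p j
            / (qpoch p p j * qpoch (c / q ^ n) q (2 * j)) * p ^ j
          * (qpoch (c / q ^ k) q (2 * j) * qpoch ((c / q ^ k)\<^sup>2 * p ^ Suc j) p (n - j))) = 0"
    (is "?sum = 0")
proof -
  define l m d X where "l = k - 1" and "m = n - k" and "d = c / q ^ n" and "X = c\<^sup>2 / p ^ l"
  have k_eq: "k = Suc l" and n_eq: "n = m + k" and l_le: "l \<le> n"
    using k by (auto simp: l_def m_def)
  have p0: "p \<noteq> 0" using q0 by (simp add: p_def)
  have d_nz: "qpoch d q i \<noteq> 0" if "i \<le> 2 * n" for i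
    using c_shift that by (auto simp: d_def qpoch_eq_0_iff)
  have c_k: "c / q ^ k = d * q ^ m"
    using q0 by (simp add: d_def n_eq power_add)
  have c_sq: "c\<^sup>2 = X * p ^ l"
    using p0 by (simp add: X_def)
  have c_k_sq: "(c / q ^ k)\<^sup>2 * p ^ Suc j = X * p ^ j" for j
  proof -
    have "(q ^ k)\<^sup>2 = p * p ^ l"
      by (simp add: p_def k_eq power_mult_distrib mult.commute flip: power_mult)
    then show ?thesis using p0 by (simp add: X_def power_divide)
  qed
  have "poly_fun_le (m + l) (\<lambda>y. qpoch (y * d) q m * qpoch (y * X) p l)"
    by (intro poly_fun_le_mult[OF poly_fun_le_qpoch poly_fun_le_qpoch]) simp
  then obtain W where "degree W \<le> m + l"
    and W: "\<And>y. qpoch (y * d) q m * qpoch (y * X) p l = poly W y"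
    by (auto simp: poly_fun_le_def)
  then have degW: "degree W < n" by (simp add: n_eq k_eq)
  define K where "K = qpoch (c\<^sup>2) p (n - l) / qpoch d q m"
  have "qpoch (1 / p ^ n) p j * qpoch (c\<^sup>2) p j
            / (qpoch p p j * qpoch (c / q ^ n) q (2 * j)) * p ^ j
          * (qpoch (c / q ^ k) q (2 * j) * qpoch ((c / q ^ k)\<^sup>2 * p ^ Suc j) p (n - j))
      = K * (qpoch (1 / p ^ n) p j / qpoch p p j * p ^ j * poly W (p ^ j))"
    (is "?lhs = _") if "j \<le> n" for j
  proof -
    have "qpoch d q m * qpoch (d * q ^ m) q (2 * j)
        = qpoch d q (2 * j) * qpoch (d * q ^ (2 * j)) q m"
      by (rule qpoch_shift_swap)
    then have "qpoch (d * q ^ m) q (2 * j) / qpoch d q (2 * j) = qpoch (p ^ j * d) q m / qpoch d q m"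
      using d_nz[of m] d_nz[of "2 * j"] that n_eq
      by (simp add: frac_eq_eq mult.commute p_def flip: power_mult)
    moreover have "qpoch (c\<^sup>2) p j * qpoch (X * p ^ j) p (n - j)
        = qpoch (X * p ^ j) p l * qpoch (c\<^sup>2) p (n - l)"
      unfolding c_sq using that l_le by (rule qpoch_exchange)
    moreover have "?lhs = qpoch (1 / p ^ n) p j / qpoch p p j * p ^ j
        * (qpoch (d * q ^ m) q (2 * j) / qpoch d q (2 * j))
        * (qpoch (c\<^sup>2) p j * qpoch (X * p ^ j) p (n - j))"
      unfolding c_k_sq unfolding c_k d_def[symmetric] by simp
    ultimately show ?thesis
      by (simp add: K_def mult_ac flip: W)
  qed
  then have "?sum = K * (\<Sum>j\<le>n. qpoch (1 / p ^ n) p j / qpoch p p j * p ^ j * poly W (p ^ j))"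
    unfolding sum_distrib_left by (intro sum.cong) auto
  then show ?thesis
    by (simp only: q_difference_low_degree[OF p0 p_root degW] mult_zero_right)
qed

text \<open>
  The factor \<open>(q\<^sup>-\<^sup>k;q)\<^sub>2\<^sub>j\<close> is zero as soon as \<open>2j > k\<close>. Otherwise \<open>j < k \<le> n\<close>, because \<open>k \<ge> 1\<close>,
  and the second product contains the factor \<open>1 - q\<^sup>-\<^sup>2\<^sup>k p\<^sup>k\<close>.
\<close>
lemma cleared_term_zero_at_powers:
  fixes q :: complex
  defines "p \<equiv> q\<^sup>2"
  assumes q0: "q \<noteq> 0" and k: "1 \<le> k" "k \<le> n"
  shows "qpoch (1 / q ^ k) q (2 * j) * qpoch ((1 / q ^ k)\<^sup>2 * p ^ Suc j) p (n - j) = 0"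
proof (cases "k < 2 * j")
  case True
  then have "qpoch (1 / q ^ k) q (2 * j) = 0"
    by (rule qpoch_eq_0I) (use q0 in simp)
  then show ?thesis by simp
next
  case False
  then have "j < k" using k by simp
  then obtain i where i: "k = Suc j + i"
    using less_imp_Suc_add[of j k] by auto
  have "(1 / q ^ k)\<^sup>2 = 1 / (p ^ Suc j * p ^ i)"
    by (simp add: p_def i power_divide power_add power_mult_distrib mult_ac flip: power_mult)
  then have "(1 / q ^ k)\<^sup>2 * p ^ Suc j * p ^ i = 1"
    using q0 by (simp add: p_def)
  moreover have "i < n - j" using i k by simp
  ultimately have "qpoch ((1 / q ^ k)\<^sup>2 * p ^ Suc j) p (n - j) = 0"
    by (intro qpoch_eq_0I)
  then show ?thesis by simp
qed

text \<open>
  The interpolation argument. The unknown is \<open>a\<close> rather than \<open>c\<close> because the hypotheses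
  then keep the nodes distinct: \<open>q\<^sup>-\<^sup>i = cq\<^sup>-\<^sup>k\<close> would mean \<open>cq\<^sup>-\<^sup>n q\<^sup>n\<^sup>+\<^sup>i\<^sup>-\<^sup>k = 1\<close>, with exponent
  \<open>n + i - k\<close> in the range \<open>[0, 2n)\<close> of \<open>c_shift\<close>. As a polynomial in \<open>c\<close> the right-hand side
  would have the zeros \<open>aq\<^sup>k\<close> and \<open>q\<^sup>-\<^sup>i\<close>, some of which may coincide.
\<close>
lemma cleared_summation:
  fixes q a c :: complex
  defines "p \<equiv> q\<^sup>2"
  assumes q0: "q \<noteq> 0" and c0: "c \<noteq> 0"
    and p_root: "\<And>k. 1 \<le> k \<Longrightarrow> k \<le> n \<Longrightarrow> p ^ k \<noteq> 1"
    and c_shift: "\<And>k. k < 2 * n \<Longrightarrow> c / q ^ n * q ^ k \<noteq> 1"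
  shows "(\<Sum>j\<le>n. qpoch (1 / p ^ n) p j * qpoch (c\<^sup>2) p j
            / (qpoch p p j * qpoch (c / q ^ n) q (2 * j)) * p ^ j
          * (qpoch a q (2 * j) * qpoch (a\<^sup>2 * p ^ Suc j) p (n - j))) * qpoch (q / c) q n
      = qpoch (- q) q n * (qpoch (a * (q / c)) q n * qpoch (a * q) q n)"
proof -
  define C where "C j = qpoch (1 / p ^ n) p j * qpoch (c\<^sup>2) p j
      / (qpoch p p j * qpoch (c / q ^ n) q (2 * j)) * p ^ j" for j
  define S where "S x = (\<Sum>j\<le>n. C j * (qpoch x q (2 * j) * qpoch (x\<^sup>2 * p ^ Suc j) p (n - j)))"
    for x
  define R where "R x = qpoch (- q) q n * (qpoch (x * (q / c)) q n * qpoch (x * q) q n)" for x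
  define A where "A = (\<lambda>k. 1 / q ^ k) ` {0..n} \<union> (\<lambda>k. c / q ^ k) ` {1..n}"
  have q_powers: "i = j" if "q ^ i = q ^ j" "i \<le> n" "j \<le> n" for i j
  proof -
    have False if "q ^ i = q ^ j" "i < j" "j \<le> n" for i j
    proof -
      have "q ^ i * q ^ (j - i) = q ^ i * 1"
        using that by (metis le_add_diff_inverse less_imp_le mult.right_neutral power_add)
      then have "q ^ (j - i) = 1" using q0 by simp
      then have "p ^ (j - i) = 1"
        unfolding p_def by (metis mult.commute power_mult power_one)
      then show False using p_root[of "j - i"] that by simp
    qed
    with that show ?thesis by (metis linorder_neqE_nat)
  qed
  have "1 / q ^ i \<noteq> c / q ^ k" if "i \<le> n" "1 \<le> k" "k \<le> n" for i k
  proof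
    assume eq: "1 / q ^ i = c / q ^ k"
    have "q ^ n * q ^ i = q ^ k * q ^ (n + i - k)"
      using that by (simp only: power_add[symmetric]) simp
    then have "c / q ^ n * q ^ (n + i - k) = (c / q ^ k) * q ^ i"
      using q0 by (simp add: field_simps)
    also have "\<dots> = 1" using q0 by (simp flip: eq)
    finally have "\<not> n + i - k < 2 * n" using c_shift by blast
    with that show False by linarith
  qed
  then have "(\<lambda>k. 1 / q ^ k) ` {0..n} \<inter> (\<lambda>k. c / q ^ k) ` {1..n} = {}"
    by auto
  moreover have "inj_on (\<lambda>k. 1 / q ^ k) {0..n}" "inj_on (\<lambda>k. c / q ^ k) {1..n}"
    using q0 c0 q_powers by (auto simp: inj_on_def frac_eq_eq)
  ultimately have card_A: "card A = 2 * n + 1"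
    by (simp add: A_def card_Un_disjoint card_image)
  have "S a * qpoch (q / c) q n = R a"
  proof (rule poly_fun_le_eqI[where A = A and d = "2 * n" and f = "\<lambda>x. S x * qpoch (q / c) q n" and g = R])
    have "poly_fun_le (2 * n) S"
      unfolding S_def
    proof (intro poly_fun_le_sum)
      fix j assume "j \<in> {..n}"
      moreover have "poly_fun_le (2 * j) (\<lambda>x. qpoch (x * 1) q (2 * j))"
        by (rule poly_fun_le_qpoch)
      ultimately have "poly_fun_le (2 * n)
          (\<lambda>x. qpoch (x * 1) q (2 * j) * qpoch (x\<^sup>2 * p ^ Suc j) p (n - j))"
        by (intro poly_fun_le_mult[OF _ poly_fun_le_qpoch_square]) auto
      then show "poly_fun_le (2 * n)
          (\<lambda>x. C j * (qpoch x q (2 * j) * qpoch (x\<^sup>2 * p ^ Suc j) p (n - j)))"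
        by (intro poly_fun_le_mult[OF poly_fun_le_const[of 0]]) auto
    qed
    then show "poly_fun_le (2 * n) (\<lambda>x. S x * qpoch (q / c) q n)"
      by (rule poly_fun_le_mult[OF _ poly_fun_le_const[of 0]]) simp
    have "poly_fun_le (2 * n) (\<lambda>x. qpoch (x * (q / c)) q n * qpoch (x * q) q n)"
      by (rule poly_fun_le_mult[OF poly_fun_le_qpoch poly_fun_le_qpoch]) simp
    then show "poly_fun_le (2 * n) R"
      unfolding R_def by (rule poly_fun_le_mult[OF poly_fun_le_const[of 0]]) simp
    show "2 * n < card A" by (simp add: card_A)
    have "{0..n} = insert 0 {1..n}" by auto
    then have A_eq: "A = {1} \<union> (\<lambda>k. 1 / q ^ k) ` {1..n} \<union> (\<lambda>k. c / q ^ k) ` {1..n}"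
      by (simp add: A_def)
    fix x assume "x \<in> A"
    then consider "x = 1" | k where "1 \<le> k" "k \<le> n" "x = 1 / q ^ k"
      | k where "1 \<le> k" "k \<le> n" "x = c / q ^ k"
      unfolding A_eq by (elim UnE imageE singletonE; (unfold atLeastAtMost_iff)?; blast)
    then show "S x * qpoch (q / c) q n = R x"
    proof cases
      case 1
      have "qpoch 1 q (2 * j) = 0" if "0 < j" for j
        using that by (auto simp: qpoch_eq_0_iff intro: exI[of _ 0])
      then have "S 1 = C 0 * qpoch p p n"
        unfolding S_def by (subst sum.remove[of _ 0]) (auto intro: sum.neutral)
      moreover have "qpoch p p n = qpoch q q n * qpoch (- q) q n"
        unfolding p_def by (rule qpoch_square)
      ultimately show ?thesis
        using 1 by (simp add: C_def R_def)
    next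
      case 2
      then have "S x = 0"
        unfolding S_def p_def
        by (intro sum.neutral ballI)
           (simp only: cleared_term_zero_at_powers[OF q0] mult_zero_right)
      moreover have "qpoch (x * q) q n = 0"
        by (rule qpoch_eq_0I[of "k - 1"]) (use 2 q0 in \<open>auto simp flip: power_Suc\<close>)
      ultimately show ?thesis by (simp add: R_def)
    next
      case 3
      then have "S x = 0"
        using cleared_sum_zero_at_shifts_of_c[OF q0 p_root[unfolded p_def] c_shift, of k]
        by (simp only: S_def C_def p_def)
      moreover have "qpoch (x * (q / c)) q n = 0"
        by (rule qpoch_eq_0I[of "k - 1"]) (use 3 q0 c0 in \<open>auto simp flip: power_Suc\<close>)
      ultimately show ?thesis by (simp add: R_def)
    qed
  qed
  then show ?thesis by (simp add: S_def C_def R_def)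
qed

theorem theorem1p5:
  fixes n :: nat and q a c :: complex
  assumes "q \<noteq> 0" and "a \<noteq> 0" and "c \<noteq> 0"
    and "\<And>j. j \<le> n \<Longrightarrow>
      qpochs [q\<^sup>2, a\<^sup>2 * q\<^sup>2, c * q powi (- int n), c * q powi (- int n + 1)] (q\<^sup>2) j \<noteq> 0"
    and "qpochs [- a * q, q / c] q n \<noteq> 0"
  shows "basic_hypergeom
      [q powi (- 2 * int n), c\<^sup>2, a, a * q]
      [a\<^sup>2 * q\<^sup>2, c * q powi (- int n), c * q powi (- int n + 1)] (q\<^sup>2) (q\<^sup>2)
    = qpochs [- q, a * q / c] q n / qpochs [- a * q, q / c] q n"
proof -
  define p where "p = q\<^sup>2"
  define b where "b = a\<^sup>2 * p"
  have p0: "p \<noteq> 0" using assms(1) by (simp add: p_def)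
  have powers: "q powi (- 2 * int n) = 1 / p ^ n" "c * q powi (- int n) = c / q ^ n"
      "c * q powi (- int n + 1) = c / q ^ n * q"
  proof -
    have "q powi (- 2 * int n) = inverse (q powi int (2 * n))"
      by (simp flip: power_int_minus)
    then show "q powi (- 2 * int n) = 1 / p ^ n"
      by (simp only: p_def power_int_of_nat power_mult inverse_eq_divide)
    show c_neg: "c * q powi (- int n) = c / q ^ n"
      by (simp add: power_int_minus divide_inverse)
    have "c * q powi (- int n + 1) = c * q powi (- int n) * q"
      using assms(1) by (simp only: power_int_add power_int_1_right mult.assoc simp_thms)
    then show "c * q powi (- int n + 1) = c / q ^ n * q"
      by (simp only: c_neg)
  qed
  have even_odd: "qpoch x p j * qpoch (x * q) p j = qpoch x q (2 * j)" for x j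
    unfolding p_def by (rule qpoch_even_odd)
  have b_pq: "b = (a * q)\<^sup>2"
    by (simp add: b_def p_def power_mult_distrib)
  have nz: "qpoch p p n \<noteq> 0" "qpoch b p n \<noteq> 0" "qpoch (c / q ^ n) q (2 * n) \<noteq> 0"
    using assms(4)[of n] unfolding powers
    by (auto simp: qpochs_def b_def simp flip: p_def even_odd)
  have p_root: "p ^ k \<noteq> 1" if k: "1 \<le> k" "k \<le> n" for k
  proof -
    have "k - 1 < n" "p * p ^ (k - 1) = p ^ k"
      using k by (simp_all flip: power_Suc)
    then show ?thesis using nz(1) by (metis qpoch_eq_0I)
  qed
  have c_shift: "c / q ^ n * q ^ k \<noteq> 1" if "k < 2 * n" for k
    using nz(3) that by (metis qpoch_eq_0I)
  have rhs_nz: "qpoch (- (a * q)) q n \<noteq> 0" "qpoch (q / c) q n \<noteq> 0"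
    using assms(5) by (auto simp: qpochs_def)
  have b_split: "qpoch b p n = qpoch (a * q) q n * qpoch (- (a * q)) q n"
    unfolding b_pq p_def by (rule qpoch_square)
  \<comment> \<open>What remains is to put the summands of the series over the common denominator \<open>(a\<^sup>2p;p)\<^sub>n\<close>.\<close>
  define C where "C j = qpoch (1 / p ^ n) p j * qpoch (c\<^sup>2) p j
      / (qpoch p p j * qpoch (c / q ^ n) q (2 * j)) * p ^ j" for j
  have "basic_hypergeom [1 / p ^ n, c\<^sup>2, a, a * q] [b, c / q ^ n, c / q ^ n * q] p p
      = (\<Sum>j\<le>n. qpochs [1 / p ^ n, c\<^sup>2, a, a * q] p j
          / qpochs [p, b, c / q ^ n, c / q ^ n * q] p j * p ^ j)"
    by (rule basic_hypergeom_terminating)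
       (use p0 in \<open>simp_all add: power_int_minus inverse_eq_divide\<close>)
  also have "\<dots> = (\<Sum>j\<le>n. C j * (qpoch a q (2 * j) * qpoch (a\<^sup>2 * p ^ Suc j) p (n - j))
      / qpoch b p n)"
  proof (intro sum.cong refl)
    fix j assume "j \<in> {..n}"
    then have split: "qpoch b p n = qpoch b p j * qpoch (a\<^sup>2 * p ^ Suc j) p (n - j)"
      using qpoch_add[of b p j "n - j"] by (simp add: b_def mult_ac)
    then have "qpoch (a\<^sup>2 * p ^ Suc j) p (n - j) \<noteq> 0"
      using nz(2) by auto
    then have "qpoch (a\<^sup>2 * p ^ Suc j) p (n - j) / qpoch b p n = 1 / qpoch b p j"
      unfolding split by simp
    moreover have "qpochs [1 / p ^ n, c\<^sup>2, a, a * q] p j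
        / qpochs [p, b, c / q ^ n, c / q ^ n * q] p j * p ^ j
        = C j * qpoch a q (2 * j) * (1 / qpoch b p j)"
      unfolding C_def even_odd[symmetric] by (simp add: qpochs_def mult_ac)
    ultimately show "qpochs [1 / p ^ n, c\<^sup>2, a, a * q] p j
        / qpochs [p, b, c / q ^ n, c / q ^ n * q] p j * p ^ j
        = C j * (qpoch a q (2 * j) * qpoch (a\<^sup>2 * p ^ Suc j) p (n - j)) / qpoch b p n"
      by (metis mult.assoc times_divide_eq_right)
  qed
  also have "\<dots> = (\<Sum>j\<le>n. C j * (qpoch a q (2 * j) * qpoch (a\<^sup>2 * p ^ Suc j) p (n - j)))
      / qpoch b p n"
    by (rule sum_divide_distrib[symmetric])
  also have "(\<Sum>j\<le>n. C j * (qpoch a q (2 * j) * qpoch (a\<^sup>2 * p ^ Suc j) p (n - j)))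
      = qpoch (- q) q n * (qpoch (a * (q / c)) q n * qpoch (a * q) q n) / qpoch (q / c) q n"
    using cleared_summation[OF assms(1,3), of n a] p_root c_shift rhs_nz(2)
    by (simp add: C_def p_def eq_divide_eq)
  also have "\<dots> / qpoch b p n = qpochs [- q, a * q / c] q n / qpochs [- a * q, q / c] q n"
    using nz(2) rhs_nz by (simp add: b_split qpochs_def)
  finally show ?thesis
    unfolding powers by (simp only: b_def p_def)
qed

end
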